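(* Let $n$ be an integer with $|n|\ge2$. The relation $\le$ is a lattice order on $L_n$. Furthermore, for $(r_1,h_1),(r_2,h_2)\in L_n\setminus\{\bot\}$, we have $(r_1,h_1)\wedge(r_2,h_2)\ne\bot$ if and only if $$r_1\frac{h_2}{\gcd(h_1,h_2)}\equiv r_2\frac{h_1}{\gcd(h_1,h_2)}\pmod{n-1}.$$
   Context: $\mathbb N$ denotes the positive integers. $L_n=\big(\{0,1,\dots,|n-1|-1\}\times\{h\in\mathbb N:\gcd(h,n)=1\}\big)\cup\{\bot\}$, and $\le$ is the partial order on $L_n$ in which $\bot$ is the least element and, for the other elements, $(r_1,h_1)\le(r_2,h_2)$ if and only if $h_1\mid h_2$ and $r_1\cdot\frac{h_2}{h_1}\equiv r_2\pmod{n-1}$. *)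

theory Defs
  imports "HOL-Algebra.Lattice" "HOL-Number_Theory.Cong"
begin

text \<open>\<^term>\<open>None\<close> stands for the element \<open>\<bottom>\<close>.\<close>

definition L_set :: "int \<Rightarrow> (int \<times> nat) option set" where
  "L_set n = Some ` ({0..\<bar>n - 1\<bar> - 1} \<times> {h. h > 0 \<and> gcd (int h) n = 1}) \<union> {None}"

text \<open>The quotient \<^term>\<open>h2 div h1\<close> is exact, as it only matters when \<^prop>\<open>h1 dvd h2\<close>.\<close>

fun L_le :: "int \<Rightarrow> (int \<times> nat) option \<Rightarrow> (int \<times> nat) option \<Rightarrow> bool" where
  "L_le n None _ \<longleftrightarrow> True"
| "L_le n (Some _) None \<longleftrightarrow> False"
| "L_le n (Some (r1, h1)) (Some (r2, h2)) \<longleftrightarrow>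
     h1 dvd h2 \<and> [r1 * int (h2 div h1) = r2] (mod (n - 1))"

definition L_order :: "int \<Rightarrow> (int \<times> nat) option gorder" where
  "L_order n = \<lparr>carrier = L_set n, eq = (=), le = L_le n\<rparr>"

end

theory Submission
  imports Defs
begin

text \<open>
  Write \<open>h1 = g * a\<close> and \<open>h2 = g * b\<close> with \<open>g = gcd h1 h2\<close>, and put \<open>d = r1 * b - r2 * a\<close>.
  An upper bound of \<open>(r1, h1)\<close> and \<open>(r2, h2)\<close> has second component \<open>g * a * b * k\<close> with
  \<open>n - 1\<close> dividing \<open>k * d\<close>; the least such \<open>k\<close> divides \<open>n - 1\<close>, hence is coprime to \<open>n\<close>, and
  gives the join. A lower bound other than \<open>\<bottom>\<close> exists iff \<open>n - 1\<close> divides \<open>d\<close>, and then the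
  meet is \<open>(u * r1 + v * r2, g)\<close>, where \<open>u * a + v * b = 1\<close>.
\<close>

section \<open>The order on \<open>L_set n\<close>\<close>

text \<open>Trades the truncating \<open>div\<close> for an explicit multiplier \<open>k\<close>; as
  \<open>h1 > 0\<close>, cancelling \<open>h1\<close> shows that this \<open>k\<close> is
  \<open>h2 div h1\<close>. Multipliers compose, which gives transitivity.\<close>

lemma L_le_Some_iff:
  assumes "h1 > 0"
  shows "L_le n (Some (r1, h1)) (Some (r2, h2)) \<longleftrightarrow>
    (\<exists>k. h2 = h1 * k \<and> [r1 * int k = r2] (mod (n - 1)))"
  using assms by (auto simp: dvd_def)

lemma Some_in_L_set_iff:
  "Some (r, h) \<in> L_set n \<longleftrightarrow> 0 \<le> r \<and> r < \<bar>n - 1\<bar> \<and> h > 0 \<and> coprime (int h) n"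
  by (auto simp: L_set_def coprime_iff_gcd_eq_1)

lemma None_in_L_set: "None \<in> L_set n"
  by (simp add: L_set_def)

lemma L_le_refl: "x \<in> L_set n \<Longrightarrow> L_le n x x"
  by (cases x) (auto simp: Some_in_L_set_iff)

lemma L_le_trans:
  assumes "x \<in> L_set n" "y \<in> L_set n" "L_le n x y" "L_le n y z"
  shows "L_le n x z"
proof (cases "x = None \<or> z = None")
  case True
  then show ?thesis
    using assms by (cases x; cases y; cases z) auto
next
  case False
  then obtain r1 h1 r3 h3 where x: "x = Some (r1, h1)" and z: "z = Some (r3, h3)"
    by auto
  obtain r2 h2 where y: "y = Some (r2, h2)"
    using assms x by (cases y) auto
  have pos: "h1 > 0" "h2 > 0"
    using assms x y by (auto simp: Some_in_L_set_iff)
  obtain k where k: "h2 = h1 * k" "[r1 * int k = r2] (mod (n - 1))"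
    using assms(3) pos unfolding x y by (auto simp only: L_le_Some_iff)
  obtain l where l: "h3 = h2 * l" "[r2 * int l = r3] (mod (n - 1))"
    using assms(4) pos unfolding y z by (auto simp only: L_le_Some_iff)
  have "[r1 * int k * int l = r3] (mod (n - 1))"
    using cong_trans[OF cong_scalar_right[OF k(2)] l(2)] .
  then have "h3 = h1 * (k * l) \<and> [r1 * int (k * l) = r3] (mod (n - 1))"
    using k l by (simp add: ac_simps)
  then show ?thesis
    unfolding x z using L_le_Some_iff[OF pos(1)] by blast
qed

lemma L_le_antisym:
  assumes "x \<in> L_set n" "y \<in> L_set n" "L_le n x y" "L_le n y x"
  shows "x = y"
proof (cases "x = None \<or> y = None")
  case True
  then show ?thesis
    using assms by (cases x; cases y) auto
next
  case False
  then obtain r1 h1 r2 h2 where x: "x = Some (r1, h1)" and y: "y = Some (r2, h2)"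
    by auto
  have h: "h1 = h2" "h1 > 0"
    using assms x y by (auto simp: Some_in_L_set_iff intro: dvd_antisym)
  \<comment> \<open>The modulus \<open>n - 1\<close> may be negative, whereas \<open>r1\<close> and
    \<open>r2\<close> are canonical residues for its absolute value.\<close>
  have "[r1 = r2] (mod \<bar>n - 1\<bar>)"
    using assms(3) x y h by simp
  then show ?thesis
    using assms(1,2) x y h
    by (auto simp: Some_in_L_set_iff intro: cong_less_imp_eq_int)
qed

section \<open>Residues and divisibility\<close>

lemma mod_abs_cong: "[r mod \<bar>m\<bar> = r] (mod m)" for r m :: int
  using cong_mod_left[of r "\<bar>m\<bar>" r] by simp

lemma Some_mod_in_L_set:
  assumes "n \<noteq> 1" "h > 0" "coprime (int h) n"
  shows "Some (r mod \<bar>n - 1\<bar>, h) \<in> L_set n"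
  using assms by (simp add: Some_in_L_set_iff)

lemma common_multiple_cofactors:
  fixes a b k l :: nat
  assumes "coprime a b" "a > 0" "a * k = b * l"
  obtains t where "k = b * t" "l = a * t"
proof -
  have "b dvd a * k"
    using assms(3) by simp
  then have "b dvd k"
    using assms(1) by (simp add: coprime_dvd_mult_right_iff coprime_commute)
  then obtain t where t: "k = b * t" ..
  have "b > 0 \<or> k = 0"
    using t by auto
  moreover have "l = a * t" if "b > 0"
    using assms(3) t that by (metis mult.left_commute mult_cancel1 not_gr0)
  \<comment> \<open>If \<open>b = 0\<close>, then \<open>k = 0\<close> and coprimality forces
    \<open>a = 1\<close>, so \<open>l\<close> itself serves as the witness.\<close>
  ultimately show thesis
    using that t assms by (cases "b = 0") auto
qed

text \<open>Cancelling \<open>gcd m d\<close> from \<open>m\<close> and \<open>d\<close> leaves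
  coprime quotients. The admissible \<open>k\<close> are thus the multiples of a single number,
  which is what singles out a least upper bound.\<close>

lemma dvd_mult_iff_div_gcd_dvd:
  fixes m d k :: int
  assumes "m \<noteq> 0"
  shows "m dvd k * d \<longleftrightarrow> m div gcd m d dvd k"
proof -
  define g where "g = gcd m d"
  have g: "g \<noteq> 0" "m = g * (m div g)" "d = g * (d div g)"
    using assms by (auto simp: g_def)
  have cop: "coprime (m div g) (d div g)"
    using assms by (auto simp: g_def intro: div_gcd_coprime)
  have "m dvd k * d \<longleftrightarrow> g * (m div g) dvd g * (k * (d div g))"
    using g by (metis mult.left_commute)
  also have "\<dots> \<longleftrightarrow> m div g dvd k"
    using g(1) cop by (simp add: coprime_dvd_mult_left_iff)
  finally show ?thesis
    by (simp add: g_def)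
qed

section \<open>Joins\<close>

text \<open>One equivalence over all \<open>w\<close> encodes both halves of a least upper bound:
  with \<open>w = z\<close>, reflexivity makes \<open>z\<close> an upper bound.\<close>

lemma L_join_exists:
  assumes "n \<noteq> 1" "x \<in> L_set n" "y \<in> L_set n"
  shows "\<exists>z \<in> L_set n. \<forall>w \<in> L_set n. L_le n z w \<longleftrightarrow> L_le n x w \<and> L_le n y w"
proof (cases "x = None \<or> y = None")
  case True
  then show ?thesis
    using assms by auto
next
  case False
  then obtain r1 h1 r2 h2 where x: "x = Some (r1, h1)" and y: "y = Some (r2, h2)"
    by auto
  have pos: "h1 > 0" "h2 > 0" and cop: "coprime (int h1) n" "coprime (int h2) n"
    using assms x y by (auto simp: Some_in_L_set_iff)
  obtain g a b where gab: "h1 = g * a" "h2 = g * b" "coprime a b"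
    using gcd_coprime_exists[of h1 h2] pos by (metis gcd_eq_0_iff mult.commute not_gr0)
  have pos': "g > 0" "a > 0" "b > 0"
    using pos gab by auto
  define m where "m = n - 1"
  define d where "d = r1 * int b - r2 * int a"
  define K where "K = nat \<bar>m div gcd m d\<bar>"
  have "m \<noteq> 0"
    using assms(1) by (simp add: m_def)
  have dvd_K: "m dvd int k * d \<longleftrightarrow> K dvd k" for k
    using dvd_mult_iff_div_gcd_dvd[OF \<open>m \<noteq> 0\<close>, of "int k" d]
    by (simp add: K_def flip: int_dvd_int_iff)
  have "m div gcd m d dvd m"
    by (metis dvd_div_mult_self dvd_triv_left gcd_dvd1)
  then have "int K dvd m"
    by (simp add: K_def)
  then have "K > 0"
    using \<open>m \<noteq> 0\<close> by (auto intro!: gr0I)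
  have "coprime m n"
    unfolding m_def by (rule coprime_diff_one_left)
  \<comment> \<open>This keeps the second component of \<open>z\<close> below coprime to
    \<open>n\<close>.\<close>
  then have copK: "coprime (int K) n"
    using \<open>int K dvd m\<close> by (meson coprime_divisors dvd_refl)
  define z where "z = Some (r1 * int (b * K) mod \<bar>n - 1\<bar>, h1 * (b * K))"
  have z: "z \<in> L_set n"
    unfolding z_def using assms(1) pos pos' \<open>K > 0\<close> cop copK gab
    by (intro Some_mod_in_L_set) auto
  have le: "L_le n x z" "L_le n y z"
  proof -
    show "L_le n x z"
      unfolding x z_def L_le_Some_iff[OF pos(1)]
      by (intro exI[of _ "b * K"]) (simp add: mod_abs_cong cong_sym)
    \<comment> \<open>The multiplier from \<open>y\<close> to \<open>z\<close> is
      \<open>a * K\<close>, and \<open>r1 * int (b * K) - r2 * int (a * K)\<close> equals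
      \<open>int K * d\<close>.\<close>
    have "m dvd int K * d"
      by (simp add: dvd_K)
    then have "[r2 * int (a * K) = r1 * int (b * K)] (mod (n - 1))"
      by (subst cong_sym_eq) (simp add: cong_iff_dvd_diff d_def m_def algebra_simps)
    then show "L_le n y z"
      unfolding y z_def L_le_Some_iff[OF pos(2)] using gab
      by (intro exI[of _ "a * K"]) (auto intro: cong_trans cong_sym[OF mod_abs_cong])
  qed
  have "L_le n z w" if w: "w \<in> L_set n" "L_le n x w" "L_le n y w" for w
  proof -
    obtain r h where w': "w = Some (r, h)"
      using w x by (cases w) auto
    obtain k1 where k1: "h = h1 * k1" "[r1 * int k1 = r] (mod (n - 1))"
      using w(2) pos unfolding x w' by (auto simp only: L_le_Some_iff)
    obtain k2 where k2: "h = h2 * k2" "[r2 * int k2 = r] (mod (n - 1))"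
      using w(3) pos unfolding y w' by (auto simp only: L_le_Some_iff)
    have "a * k1 = b * k2"
      using k1(1) k2(1) gab pos' by simp
    then obtain t where t: "k1 = b * t" "k2 = a * t"
      using common_multiple_cofactors gab pos' by metis
    \<comment> \<open>Both sides represent \<open>r\<close>, and their difference is
      \<open>int t * d\<close>; so \<open>K\<close> divides \<open>t\<close>, and the quotient
      \<open>s\<close> is the multiplier from \<open>z\<close> to \<open>w\<close>.\<close>
    have "[r1 * int k1 = r2 * int k2] (mod (n - 1))"
      using k1(2) k2(2) cong_sym cong_trans by blast
    then have "m dvd int t * d"
      by (simp add: t cong_iff_dvd_diff m_def d_def algebra_simps)
    then obtain s where s: "t = K * s"
      using dvd_K by auto
    have "[r1 * int (b * K) mod \<bar>n - 1\<bar> * int s = r1 * int (b * K) * int s] (mod (n - 1))"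
      by (intro cong_scalar_right mod_abs_cong)
    also have "r1 * int (b * K) * int s = r1 * int k1"
      by (simp add: s t)
    also note k1(2)
    finally have "[r1 * int (b * K) mod \<bar>n - 1\<bar> * int s = r] (mod (n - 1))" .
    moreover have "h = h1 * (b * K) * s"
      using k1(1) s t by simp
    ultimately show ?thesis
      unfolding w' z_def using pos pos' \<open>K > 0\<close> by (subst L_le_Some_iff) auto
  qed
  then show ?thesis
    using z le L_le_trans[OF assms(2) z] L_le_trans[OF assms(3) z] by blast
qed

section \<open>Meets\<close>

text \<open>A first component \<open>s\<close> over \<open>g\<close> must satisfy
  \<open>s * a \<equiv> r1\<close> and \<open>s * b \<equiv> r2\<close>, and the Bezout combination
  of these forces \<open>s \<equiv> u * r1 + v * r2\<close>. The congruence hypothesis ensures that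
  this value works.\<close>

lemma L_meet_Some:
  assumes "n \<noteq> 1" and in1: "Some (r1, h1) \<in> L_set n" and in2: "Some (r2, h2) \<in> L_set n"
    and cong: "[r1 * int (h2 div gcd h1 h2) = r2 * int (h1 div gcd h1 h2)] (mod (n - 1))"
  shows "\<exists>r h. Some (r, h) \<in> L_set n \<and> (\<forall>w \<in> L_set n.
    L_le n w (Some (r, h)) \<longleftrightarrow> L_le n w (Some (r1, h1)) \<and> L_le n w (Some (r2, h2)))"
proof -
  have pos: "h1 > 0" "h2 > 0" and cop: "coprime (int h1) n" "coprime (int h2) n"
    using in1 in2 by (auto simp: Some_in_L_set_iff)
  define g where "g = gcd h1 h2"
  define a where "a = h1 div g"
  define b where "b = h2 div g"
  have gab: "h1 = g * a" "h2 = g * b" "coprime a b"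
    using pos by (auto simp: g_def a_def b_def intro: div_gcd_coprime)
  have pos': "g > 0" "a > 0" "b > 0"
    using pos gab by auto
  have ab: "[r1 * int b = r2 * int a] (mod (n - 1))"
    using cong by (simp add: a_def b_def g_def)
  obtain u v where uv: "u * int a + v * int b = 1"
    using gab(3) bezout_int[of "int a" "int b"] by auto
  define r where "r = (u * r1 + v * r2) mod \<bar>n - 1\<bar>"
  have r: "[r = u * r1 + v * r2] (mod (n - 1))"
    unfolding r_def by (rule mod_abs_cong)
  have ra: "[r * int a = r1] (mod (n - 1))"
  proof -
    have "[r * int a = (u * r1 + v * r2) * int a] (mod (n - 1))"
      using r by (rule cong_scalar_right)
    also have "(u * r1 + v * r2) * int a = u * int a * r1 + v * (r2 * int a)"
      by (simp add: algebra_simps)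
    \<comment> \<open>The hypothesis trades \<open>r2 * int a\<close> for \<open>r1 * int b\<close>,
      so that \<open>r1\<close> factors out with Bezout coefficient 1.\<close>
    also have "[\<dots> = u * int a * r1 + v * (r1 * int b)] (mod (n - 1))"
      using cong_sym[OF ab] by (intro cong_add cong_scalar_left cong_refl)
    also have "u * int a * r1 + v * (r1 * int b) = (u * int a + v * int b) * r1"
      by (simp add: algebra_simps)
    finally show ?thesis
      by (simp add: uv)
  qed
  have rb: "[r * int b = r2] (mod (n - 1))"
  proof -
    have "[r * int b = (u * r1 + v * r2) * int b] (mod (n - 1))"
      using r by (rule cong_scalar_right)
    also have "(u * r1 + v * r2) * int b = u * (r1 * int b) + v * int b * r2"
      by (simp add: algebra_simps)
    also have "[\<dots> = u * (r2 * int a) + v * int b * r2] (mod (n - 1))"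
      using ab by (intro cong_add cong_scalar_left cong_refl)
    also have "u * (r2 * int a) + v * int b * r2 = (u * int a + v * int b) * r2"
      by (simp add: algebra_simps)
    finally show ?thesis
      by (simp add: uv)
  qed
  have z: "Some (r, g) \<in> L_set n"
    unfolding r_def using assms(1) pos' cop gab by (intro Some_mod_in_L_set) auto
  have le: "L_le n (Some (r, g)) (Some (r1, h1))" "L_le n (Some (r, g)) (Some (r2, h2))"
    using ra rb gab by (auto simp only: L_le_Some_iff[OF pos'(1)])
  have "L_le n w (Some (r, g))"
    if w: "w \<in> L_set n" "L_le n w (Some (r1, h1))" "L_le n w (Some (r2, h2))" for w
  proof (cases w)
    case None
    then show ?thesis by simp
  next
    case (Some p)
    then obtain s h where w': "w = Some (s, h)"
      by (cases p) auto
    have "h > 0"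
      using w w' by (simp add: Some_in_L_set_iff)
    have "h dvd g"
      using w w' by (simp add: g_def)
    then obtain k where k: "g = h * k" ..
    have sa: "[s * int (k * a) = r1] (mod (n - 1))"
      using w(2) \<open>h > 0\<close> by (simp add: w' gab(1) k mult.assoc)
    have sb: "[s * int (k * b) = r2] (mod (n - 1))"
      using w(3) \<open>h > 0\<close> by (simp add: w' gab(2) k mult.assoc)
    \<comment> \<open>Neither \<open>a\<close> nor \<open>b\<close> need be invertible modulo
      \<open>n - 1\<close>, so \<open>s * int k\<close> is recovered from both products
      together.\<close>
    have "s * int k = s * int k * (u * int a + v * int b)"
      by (simp add: uv)
    also have "\<dots> = u * (s * int (k * a)) + v * (s * int (k * b))"
      by (simp add: algebra_simps)
    also have "[\<dots> = u * r1 + v * r2] (mod (n - 1))"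
      using sa sb by (intro cong_add cong_scalar_left)
    also note cong_sym[OF r]
    finally show ?thesis
      unfolding w' L_le_Some_iff[OF \<open>h > 0\<close>] using k by blast
  qed
  then show ?thesis
    using z le L_le_trans[OF _ z] by blast
qed

text \<open>With multipliers \<open>k\<close> and \<open>l\<close> from \<open>h\<close> to
  \<open>h1\<close> and \<open>h2\<close>, both \<open>h * (k * h2)\<close> and
  \<open>h * (l * h1)\<close> are \<open>h1 * h2\<close>. Cancelling \<open>h\<close> and dividing
  by the gcd makes the two sides the same multiple of \<open>r\<close>.\<close>

lemma lower_bound_imp_cong:
  assumes "h > 0" "h1 > 0" "h2 > 0"
    and "L_le n (Some (r, h)) (Some (r1, h1))" "L_le n (Some (r, h)) (Some (r2, h2))"
  shows "[r1 * int (h2 div gcd h1 h2) = r2 * int (h1 div gcd h1 h2)] (mod (n - 1))"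
proof -
  obtain k where k: "h1 = h * k" "[r * int k = r1] (mod (n - 1))"
    using assms by (auto simp only: L_le_Some_iff)
  obtain l where l: "h2 = h * l" "[r * int l = r2] (mod (n - 1))"
    using assms by (auto simp only: L_le_Some_iff)
  define g where "g = gcd h1 h2"
  have "k * (h2 div g) = l * (h1 div g)"
  proof -
    have "g dvd h1" "g dvd h2" "h * (k * h2) = h * (l * h1)"
      by (simp_all add: g_def k(1) l(1))
    then show ?thesis
      using \<open>h > 0\<close> by (simp add: div_mult_swap)
  qed
  then have eq: "r * int k * int (h2 div g) = r * int l * int (h1 div g)"
    by (metis mult.assoc of_nat_mult)
  have "[r1 * int (h2 div g) = r * int k * int (h2 div g)] (mod (n - 1))"
    by (intro cong_scalar_right cong_sym[OF k(2)])
  also note eq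
  also have "[r * int l * int (h1 div g) = r2 * int (h1 div g)] (mod (n - 1))"
    by (intro cong_scalar_right l(2))
  finally show ?thesis
    by (simp add: g_def)
qed

text \<open>Splitting on a common lower bound other than \<open>None\<close> also covers the
  arguments equal to \<open>None\<close>: without such a bound, \<open>None\<close> is the
  meet.\<close>

lemma L_meet_exists:
  assumes "n \<noteq> 1" "x \<in> L_set n" "y \<in> L_set n"
  shows "\<exists>z \<in> L_set n. \<forall>w \<in> L_set n. L_le n w z \<longleftrightarrow> L_le n w x \<and> L_le n w y"
proof (cases "\<exists>w \<in> L_set n. w \<noteq> None \<and> L_le n w x \<and> L_le n w y")
  case True
  then obtain r h where w: "Some (r, h) \<in> L_set n" "L_le n (Some (r, h)) x" "L_le n (Some (r, h)) y"
    by auto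
  obtain r1 h1 where x: "x = Some (r1, h1)"
    using w(2) by (cases x) auto
  obtain r2 h2 where y: "y = Some (r2, h2)"
    using w(3) by (cases y) auto
  have "h > 0" "h1 > 0" "h2 > 0"
    using w(1) assms x y by (auto simp: Some_in_L_set_iff)
  then have "[r1 * int (h2 div gcd h1 h2) = r2 * int (h1 div gcd h1 h2)] (mod (n - 1))"
    using lower_bound_imp_cong w x y by blast
  then show ?thesis
    using L_meet_Some assms x y by blast
next
  case False
  then have "\<forall>w \<in> L_set n. L_le n w None \<longleftrightarrow> L_le n w x \<and> L_le n w y"
    by (metis L_le.simps(1,2) option.exhaust prod.exhaust)
  then show ?thesis
    using None_in_L_set by blast
qed

section \<open>The lattice and the criterion for a meet other than \<open>None\<close>\<close>

lemma partial_order_L_order: "partial_order (L_order n)"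
  by unfold_locales
    (auto simp: L_order_def intro: L_le_refl L_le_antisym L_le_trans)

lemma lattice_L_order:
  assumes "n \<noteq> 1"
  shows "lattice (L_order n)"
proof -
  interpret partial_order "L_order n"
    by (rule partial_order_L_order)
  show ?thesis
  proof
    fix x y
    assume "x \<in> carrier (L_order n)" "y \<in> carrier (L_order n)"
    then have xy: "x \<in> L_set n" "y \<in> L_set n"
      by (simp_all add: L_order_def)
    show "\<exists>s. least (L_order n) s (Upper (L_order n) {x, y})"
    proof -
      obtain z where "z \<in> L_set n" "\<forall>w \<in> L_set n. L_le n z w \<longleftrightarrow> L_le n x w \<and> L_le n y w"
        using L_join_exists[OF assms xy] by blast
      then show ?thesis
        using xy L_le_refl[of z n] by (intro exI[of _ z]) (auto simp: least_def Upper_def L_order_def)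
    qed
    show "\<exists>s. greatest (L_order n) s (Lower (L_order n) {x, y})"
    proof -
      obtain z where "z \<in> L_set n" "\<forall>w \<in> L_set n. L_le n w z \<longleftrightarrow> L_le n w x \<and> L_le n w y"
        using L_meet_exists[OF assms xy] by blast
      then show ?thesis
        using xy L_le_refl[of z n] by (intro exI[of _ z]) (auto simp: greatest_def Lower_def L_order_def)
    qed
  qed
qed

theorem theorem4p3:
  fixes n :: int
  assumes "\<bar>n\<bar> \<ge> 2"
  shows "lattice (L_order n) \<and>
    (\<forall>r1 h1 r2 h2.
      Some (r1, h1) \<in> carrier (L_order n) \<longrightarrow> Some (r2, h2) \<in> carrier (L_order n) \<longrightarrow>
      (Some (r1, h1) \<sqinter>\<^bsub>L_order n\<^esub> Some (r2, h2) \<noteq> None \<longleftrightarrow>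
       [r1 * int (h2 div gcd h1 h2) = r2 * int (h1 div gcd h1 h2)] (mod (n - 1))))"
proof (intro conjI allI impI)
  have "n \<noteq> 1"
    using assms by auto
  then show "lattice (L_order n)"
    by (rule lattice_L_order)
  then interpret lattice "L_order n" .
  fix r1 r2 :: int and h1 h2 :: nat
  let ?x = "Some (r1, h1)" and ?y = "Some (r2, h2)"
  let ?z = "?x \<sqinter>\<^bsub>L_order n\<^esub> ?y"
  assume x: "?x \<in> carrier (L_order n)" and y: "?y \<in> carrier (L_order n)"
  have xL: "?x \<in> L_set n" and yL: "?y \<in> L_set n"
    using x y by (simp_all add: L_order_def)
  have zL: "?z \<in> L_set n" and zx: "L_le n ?z ?x" and zy: "L_le n ?z ?y"
    using meet_closed[OF x y] meet_left[OF x y] meet_right[OF x y] by (simp_all add: L_order_def)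
  show "?z \<noteq> None \<longleftrightarrow>
    [r1 * int (h2 div gcd h1 h2) = r2 * int (h1 div gcd h1 h2)] (mod (n - 1))"
  proof
    assume "?z \<noteq> None"
    then obtain r h where z: "?z = Some (r, h)"
      by auto
    have "h > 0" "h1 > 0" "h2 > 0"
      using zL xL yL by (auto simp: z Some_in_L_set_iff)
    then show "[r1 * int (h2 div gcd h1 h2) = r2 * int (h1 div gcd h1 h2)] (mod (n - 1))"
      using lower_bound_imp_cong zx zy unfolding z by blast
  next
    assume "[r1 * int (h2 div gcd h1 h2) = r2 * int (h1 div gcd h1 h2)] (mod (n - 1))"
    \<comment> \<open>The meet lies above this lower bound, while no \<open>Some\<close> element
      lies below \<open>None\<close>.\<close>
    then obtain r h where w: "Some (r, h) \<in> L_set n"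
      "L_le n (Some (r, h)) ?x" "L_le n (Some (r, h)) ?y"
      using L_meet_Some[OF \<open>n \<noteq> 1\<close> xL yL] L_le_refl[of _ n] by blast
    then have "L_le n (Some (r, h)) ?z"
      using meet_le[of "Some (r, h)" ?x ?y] x y by (simp add: L_order_def)
    then show "?z \<noteq> None"
      by (cases ?z) auto
  qed
qed

end
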